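(* Let $n\ge1$. For every $\sigma>0$ and every $1\le p\le\infty$, the operator $u\mapsto\tau_{\cdot,u}(\sigma)$ defines a bounded linear map on $L^p(\mathbb{R}^n)$. More precisely, there is a finite constant $C(\sigma)$ such that $$\|\tau_{\cdot,u}(\sigma)\|_{L^p}\le C(\sigma)\,\|u\|_{L^p}\qquad\text{for all }u\in L^p(\mathbb{R}^n).$$
   Context: $\gamma_\sigma(x)=(2\pi\sigma^2)^{-n/2}\exp(-|x|^2/(2\sigma^2))$ is the Gaussian kernel on $\mathbb{R}^n$. For $u\in L^p(\mathbb{R}^n)$, $z\in\mathbb{R}^n$ and $\sigma>0$, the pointwise multiscale texture operator is $\tau_{z,u}(\sigma)=\frac{\partial}{\partial\sigma}(u*\gamma_\sigma)(z)$; equivalently $\tau_{z,u}(\sigma)=(u*\Phi_\sigma)(z)$ with $\Phi_\sigma=\partial_\sigma\gamma_\sigma=\sigma\Delta\gamma_\sigma$. *)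

theory Defs
  imports "HOL-Analysis.Analysis" "HOL-Probability.Essential_Supremum"
begin

text \<open>
  An element of $L^p$ is represented by any of its Lebesgue measurable representatives; the
  identification of almost everywhere equal functions is made explicit in the
  notion of a bounded linear operator below. The exponent ranges over the extended
  nonnegative reals.
\<close>

definition Lp_space :: "ennreal \<Rightarrow> (real ^ 'n::finite \<Rightarrow> real) set" where
  "Lp_space p =
     (if p = \<infinity> then {u \<in> borel_measurable lebesgue. esssup lebesgue (\<lambda>x. ereal \<bar>u x\<bar>) < \<infinity>}
      else {u \<in> borel_measurable lebesgue. integrable lebesgue (\<lambda>x. \<bar>u x\<bar> powr enn2real p)})"

text \<open>The conversions to real numbers are only meaningful on \<open>Lp_space p\<close>.\<close>

definition Lp_norm :: "ennreal \<Rightarrow> (real ^ 'n::finite \<Rightarrow> real) \<Rightarrow> real" where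
  "Lp_norm p u =
     (if p = \<infinity> then real_of_ereal (esssup lebesgue (\<lambda>x. ereal \<bar>u x\<bar>))
      else (LINT x|lebesgue. \<bar>u x\<bar> powr enn2real p) powr (1 / enn2real p))"

text \<open>
  The second clause says that \<open>T\<close> descends to almost everywhere equality classes; the first
  and the remaining ones say that the induced map is a bounded linear map of $L^p$ into itself.
\<close>

definition bounded_linear_Lp ::
    "ennreal \<Rightarrow> ((real ^ 'n::finite \<Rightarrow> real) \<Rightarrow> (real ^ 'n \<Rightarrow> real)) \<Rightarrow> bool" where
  "bounded_linear_Lp p T \<longleftrightarrow>
     (\<forall>u\<in>Lp_space p. T u \<in> Lp_space p) \<and>
     (\<forall>u\<in>Lp_space p. \<forall>v\<in>Lp_space p.
        (AE x in lebesgue. u x = v x) \<longrightarrow> (AE x in lebesgue. T u x = T v x)) \<and>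
     (\<forall>u\<in>Lp_space p. \<forall>v\<in>Lp_space p. AE x in lebesgue. T (\<lambda>y. u y + v y) x = T u x + T v x) \<and>
     (\<forall>c. \<forall>u\<in>Lp_space p. AE x in lebesgue. T (\<lambda>y. c * u y) x = c * T u x) \<and>
     (\<exists>K. \<forall>u\<in>Lp_space p. Lp_norm p (T u) \<le> K * Lp_norm p u)"

definition gauss_kernel :: "real \<Rightarrow> real ^ 'n::finite \<Rightarrow> real" where
  "gauss_kernel \<sigma> x =
     (2 * pi * \<sigma>\<^sup>2) powr (- real CARD('n) / 2) * exp (- (norm x)\<^sup>2 / (2 * \<sigma>\<^sup>2))"

definition conv :: "(real ^ 'n::finite \<Rightarrow> real) \<Rightarrow> (real ^ 'n \<Rightarrow> real) \<Rightarrow> real ^ 'n \<Rightarrow> real" where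
  "conv u g z = (LINT y|lebesgue. u y * g (z - y))"

definition texture :: "real ^ 'n::finite \<Rightarrow> (real ^ 'n \<Rightarrow> real) \<Rightarrow> real \<Rightarrow> real" where
  "texture z u \<sigma> = deriv (\<lambda>s. conv u (gauss_kernel s) z) \<sigma>"

text \<open>
  Both \<open>deriv\<close> and the Lebesgue integral are total in HOL, so that the existence of the objects
  in the definition of \<open>texture\<close> has to be asserted separately.
\<close>

definition texture_well_defined :: "real ^ 'n::finite \<Rightarrow> (real ^ 'n \<Rightarrow> real) \<Rightarrow> real \<Rightarrow> bool" where
  "texture_well_defined z u \<sigma> \<longleftrightarrow>
     (\<forall>s>0. integrable lebesgue (\<lambda>y. u y * gauss_kernel s (z - y))) \<and>
     (\<lambda>s. conv u (gauss_kernel s) z) differentiable (at \<sigma>)"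

end

theory Submission
  imports Defs "HOL-Probability.Distributions"
begin

text \<open>
  On a compact range of scales $s > 0$ the kernel $\partial_s \gamma_s$ is dominated by one Gaussian
  $G$, so that differentiation under the integral gives $\tau_{\cdot,u}(\sigma) = u * \partial_\sigma \gamma_\sigma$.
  Since $a \le 1 + a^q$ for $q \ge 1$, a function in $L^p$ is integrable against every Gaussian, and
  Hoelder's inequality is not needed. Young's inequality, proved by Jensen and Tonelli, then yields
  the bound with $C(\sigma) = \int G$, whatever $p$ is.
\<close>

section \<open>Gaussian integrals, and reflection and translation of Lebesgue measure\<close>

text \<open>The integrand is a product of functions of single coordinates, so its integral is a
  power of the one-dimensional one.\<close>

lemma integrable_gaussian:
  fixes c :: real
  assumes "c > 0"
  shows "integrable lborel (\<lambda>x :: 'a::euclidean_space. exp (- c * (norm x)\<^sup>2))"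
proof (rule integrableI_bounded)
  have one: "(\<integral>\<^sup>+t. ennreal (exp (- c * t\<^sup>2)) \<partial>lborel) < \<infinity>"
  proof -
    \<comment> \<open>Standard deviation \<open>1 / sqrt (2 * c)\<close> produces the exponent
      \<open>- c * t\<^sup>2\<close>, and \<open>sqrt (pi / c)\<close> cancels the normalisation of
      the density.\<close>
    have "integrable lborel (\<lambda>t. sqrt (pi / c) * normal_density 0 (1 / sqrt (2 * c)) t)"
      using assms by (intro integrable_mult_right integrable_normal_density) simp
    moreover have "(\<lambda>t. sqrt (pi / c) * normal_density 0 (1 / sqrt (2 * c)) t) = (\<lambda>t. exp (- c * t\<^sup>2))"
      using assms by (auto simp: normal_density_def power_divide real_sqrt_divide real_sqrt_mult field_simps)
    ultimately have "integrable lborel (\<lambda>t. exp (- c * t\<^sup>2))"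
      by simp
    then show ?thesis
      by (simp add: integrable_iff_bounded)
  qed
  have "exp (- c * (norm x)\<^sup>2) = (\<Prod>b\<in>Basis. exp (- c * (x \<bullet> b)\<^sup>2))" for x :: 'a
  proof -
    have "(norm x)\<^sup>2 = (\<Sum>b\<in>Basis. (x \<bullet> b)\<^sup>2)"
      by (subst power2_norm_eq_inner, subst euclidean_inner) (simp add: power2_eq_square)
    then show ?thesis
      by (simp add: sum_distrib_left exp_sum flip: sum_negf)
  qed
  then have "(\<integral>\<^sup>+x. ennreal (norm (exp (- c * (norm (x::'a))\<^sup>2))) \<partial>lborel)
      = (\<integral>\<^sup>+(x::'a). (\<Prod>b\<in>Basis. ennreal (exp (- c * (x \<bullet> b)\<^sup>2))) \<partial>lborel)"
    by (simp add: prod_ennreal abs_prod)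
  also have "\<dots> = (\<Prod>b\<in>(Basis::'a set). (\<integral>\<^sup>+t. ennreal (exp (- c * t\<^sup>2)) \<partial>lborel))"
    by (rule nn_integral_lborel_prod) auto
  also have "\<dots> < \<infinity>"
    using one by (simp add: power_less_top_ennreal)
  finally show "(\<integral>\<^sup>+x. ennreal (norm (exp (- c * (norm (x::'a))\<^sup>2))) \<partial>lborel) < \<infinity>" .
qed simp

lemma lborel_distr_reflect:
  fixes z :: "'a::euclidean_space"
  shows "distr lborel borel (\<lambda>y. z - y) = lborel"
  using lborel_affine[of "-1" z]
  by (simp add: density_1 flip: one_ennreal_def)

lemma lborel_distr_shift:
  fixes z :: "'a::euclidean_space"
  shows "distr lborel borel (\<lambda>y. y - z) = lborel"
  using lborel_distr_plus[of "- z"] by (simp add: uminus_add_conv_diff cong: distr_cong)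

lemma integrable_reflect:
  fixes k :: "'a::euclidean_space \<Rightarrow> real"
  assumes [measurable]: "k \<in> borel_measurable borel" and "integrable lborel k"
  shows "integrable lborel (\<lambda>y. k (z - y))"
  using assms(2) by (subst (asm) lborel_distr_reflect[of z, symmetric]) (simp add: integrable_distr_eq)

lemma integral_reflect:
  fixes k :: "'a::euclidean_space \<Rightarrow> real"
  assumes [measurable]: "k \<in> borel_measurable borel"
  shows "(\<integral>y. k (z - y) \<partial>lborel) = (\<integral>y. k y \<partial>lborel)"
  by (subst (2) lborel_distr_reflect[of z, symmetric]) (simp add: integral_distr)

lemma nn_integral_shift:
  fixes k :: "'a::euclidean_space \<Rightarrow> ennreal"
  assumes [measurable]: "k \<in> borel_measurable borel"
  shows "(\<integral>\<^sup>+x. k (x - y) \<partial>lborel) = (\<integral>\<^sup>+x. k x \<partial>lborel)"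
  by (subst (2) lborel_distr_shift[of y, symmetric]) (simp add: nn_integral_distr)

section \<open>Jensen's inequality for powers\<close>

text \<open>Convexity of the power function on the open half-line. The boundary point
  \<open>a = 0\<close> is checked by hand: there the right side equals
  \<open>(1 - q) * t powr q\<close>, which is at most 0.\<close>

lemma powr_above_tangent:
  fixes a t q :: real
  assumes "a \<ge> 0" "t > 0" "q \<ge> 1"
  shows "a powr q \<ge> t powr q + q * t powr (q - 1) * (a - t)"
proof (cases "a = 0")
  case True
  have "t powr q = t powr (q - 1) * t"
    using assms by (simp add: powr_diff)
  with True assms show ?thesis
    by (simp add: mult_right_mono)
next
  case False
  have "a powr q - t powr q \<ge> (q * t powr (q - 1)) * (a - t)"
  proof (rule convex_on_imp_above_tangent[of "{0<..}"])
    show "convex_on {0<..} (\<lambda>x. x powr q)"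
      using powr_convex assms by blast
    show "((\<lambda>x. x powr q) has_real_derivative q * t powr (q - 1)) (at t within {0<..})"
      using assms by (auto intro!: derivative_eq_intros)
  qed (use False assms in \<open>auto simp: interior_open\<close>)
  then show ?thesis by simp
qed

text \<open>Jensen's inequality for the weight \<open>w\<close>: integrate the tangent line inequality at the
  \<open>w\<close>-average of \<open>v\<close>.\<close>
lemma powr_integral_le:
  fixes v w :: "'a \<Rightarrow> real"
  assumes v: "\<And>y. v y \<ge> 0" and w: "\<And>y. w y \<ge> 0" and q: "q \<ge> 1"
    and iw: "integrable M w" and ivw: "integrable M (\<lambda>y. v y * w y)"
    and ivqw: "integrable M (\<lambda>y. v y powr q * w y)"
    and C: "C = (\<integral>y. w y \<partial>M)" "C > 0"
  shows "(\<integral>y. v y * w y \<partial>M) powr q \<le> C powr (q - 1) * (\<integral>y. v y powr q * w y \<partial>M)"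
proof -
  define I where "I = (\<integral>y. v y * w y \<partial>M)"
  have nn: "(\<integral>y. v y powr q * w y \<partial>M) \<ge> 0" "I \<ge> 0"
    unfolding I_def using v w by (auto intro!: integral_nonneg_AE)
  show ?thesis
  proof (cases "I = 0")
    \<comment> \<open>A zero average offers no positive point for the tangent line, but then the
      left side is 0.\<close>
    case True
    then show ?thesis using nn q by (simp add: I_def[symmetric])
  next
    case False
    define t where "t = I / C"
    have t: "t > 0" using False nn C by (simp add: t_def)
    have "(\<integral>y. t powr q * w y + q * t powr (q - 1) * (v y * w y - t * w y) \<partial>M)
        \<le> (\<integral>y. v y powr q * w y \<partial>M)"
    proof (rule integral_mono)
      show "integrable M (\<lambda>y. t powr q * w y + q * t powr (q - 1) * (v y * w y - t * w y))"
        using iw ivw by auto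
      show "t powr q * w y + q * t powr (q - 1) * (v y * w y - t * w y) \<le> v y powr q * w y" for y
        using mult_right_mono[OF powr_above_tangent[OF v[of y] t q] w[of y]]
        by (simp add: algebra_simps)
    qed (fact ivqw)
    also have "(\<integral>y. t powr q * w y + q * t powr (q - 1) * (v y * w y - t * w y) \<partial>M)
        = t powr q * C + q * t powr (q - 1) * (I - t * C)"
      using iw ivw by (simp add: C(1) I_def)
    \<comment> \<open>The tangent point \<open>t = I / C\<close> is the one at which the linear term
      integrates to zero.\<close>
    also have "\<dots> = t powr q * C"
      using C by (simp add: t_def)
    finally have *: "t powr q * C \<le> (\<integral>y. v y powr q * w y \<partial>M)" .
    have "I powr q = C powr (q - 1) * (t powr q * C)"
      using C nn by (simp add: t_def powr_divide powr_diff)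
    also have "\<dots> \<le> C powr (q - 1) * (\<integral>y. v y powr q * w y \<partial>M)"
      using * by (intro mult_left_mono) auto
    finally show ?thesis by (simp add: I_def)
  qed
qed

section \<open>Functions integrable against every Gaussian\<close>

lemma le_one_add_powr:
  fixes a q :: real
  assumes "a \<ge> 0" "q \<ge> 1"
  shows "a \<le> 1 + a powr q"
proof (cases "a \<le> 1")
  case False
  then have "a powr 1 \<le> a powr q"
    using assms by (intro powr_mono) auto
  then show ?thesis using False by simp
qed (simp add: add_increasing2)

text \<open>Passes to Borel functions, for which measurability of convolutions and Tonelli are
  argued over \<open>lborel\<close>.\<close>

lemma lebesgue_borel_representative:
  fixes u :: "'a::euclidean_space \<Rightarrow> real"
  assumes "u \<in> borel_measurable lebesgue"
  obtains u' where "u' \<in> borel_measurable borel" "AE x in lebesgue. u x = u' x"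
  using completion_ex_borel_measurable_real[OF assms] AE_completion by auto

text \<open>A common home for all the spaces $L^p$ on which the convolutions below converge everywhere.\<close>
definition gauss_tempered :: "('a::euclidean_space \<Rightarrow> real) \<Rightarrow> bool" where
  "gauss_tempered u \<longleftrightarrow> u \<in> borel_measurable lebesgue \<and>
     (\<forall>c>0. \<forall>z. integrable lebesgue (\<lambda>y. u y * exp (- c * (norm (z - y))\<^sup>2)))"

lemma integrable_lebesgue_gaussian:
  fixes z :: "'a::euclidean_space"
  assumes "c > 0"
  shows "integrable lebesgue (\<lambda>y. exp (- c * (norm (z - y))\<^sup>2))"
proof -
  have "integrable lborel (\<lambda>y. exp (- c * (norm (z - y))\<^sup>2))"
    using integrable_reflect[OF _ integrable_gaussian[OF assms, where ?'a='a], of z] by simp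
  then show ?thesis
    by (simp add: integrable_completion)
qed

lemma borel_imp_lebesgue_measurable:
  fixes k :: "'a::euclidean_space \<Rightarrow> real"
  assumes "k \<in> borel_measurable borel"
  shows "k \<in> borel_measurable lebesgue"
  using assms by (intro measurable_completion) simp

text \<open>The Gaussian factor \<open>E\<close> is integrable and at most 1. For
  \<open>p = \<infinity>\<close> the product is dominated by a multiple of \<open>E\<close>; for
  finite \<open>p\<close> with exponent \<open>q\<close> it is dominated by
  \<open>\<bar>u\<bar> powr q + E\<close>.\<close>

lemma gauss_tempered_Lp:
  fixes u :: "real ^ 'n::finite \<Rightarrow> real"
  assumes "u \<in> Lp_space p" "p \<ge> 1"
  shows "gauss_tempered u"
  unfolding gauss_tempered_def
proof (intro conjI allI impI)
  show um[measurable]: "u \<in> borel_measurable lebesgue"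
    using assms by (auto simp: Lp_space_def split: if_splits)
  fix c :: real and z :: "real ^ 'n"
  assume c: "c > 0"
  let ?E = "\<lambda>y. exp (- c * (norm (z - y))\<^sup>2)"
  have E: "integrable lebesgue ?E" by (rule integrable_lebesgue_gaussian[OF c])
  have E1: "?E y \<le> 1" for y using c by simp
  have meas: "(\<lambda>y. u y * ?E y) \<in> borel_measurable lebesgue"
    using um E by (intro borel_measurable_times) auto
  show "integrable lebesgue (\<lambda>y. u y * ?E y)"
  proof (cases "p = \<infinity>")
    case True
    define L where "L = esssup lebesgue (\<lambda>x. ereal \<bar>u x\<bar>)"
    have "L < \<infinity>" using True assms by (simp add: L_def Lp_space_def)
    then obtain r where r: "L \<le> ereal r"
      by (cases L) auto
    have bd: "AE x in lebesgue. \<bar>u x\<bar> \<le> r"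
      using esssup_AE[of "\<lambda>x. ereal \<bar>u x\<bar>" lebesgue]
      by eventually_elim (use r order_trans L_def in fastforce)
    have ir: "integrable lebesgue (\<lambda>y. r * ?E y)" using E by simp
    show ?thesis
      by (rule Bochner_Integration.integrable_bound[OF ir meas], use bd in eventually_elim)
        (auto simp: abs_mult)
  next
    case False
    define q where "q = enn2real p"
    have q: "q \<ge> 1"
      using False assms(2) unfolding q_def
      by (metis enn2real_1 enn2real_mono infinity_ennreal_def less_top)
    have iq: "integrable lebesgue (\<lambda>y. \<bar>u y\<bar> powr q + ?E y)"
      using False assms(1) E by (simp add: Lp_space_def q_def)
    show ?thesis
    proof (rule Bochner_Integration.integrable_bound[OF iq meas], rule AE_I2)
      fix y
      have "\<bar>u y\<bar> * ?E y \<le> (1 + \<bar>u y\<bar> powr q) * ?E y"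
        using le_one_add_powr[of "\<bar>u y\<bar>" q] q by (intro mult_right_mono) auto
      also have "\<dots> \<le> \<bar>u y\<bar> powr q + ?E y"
        using mult_left_mono[OF E1[of y], of "\<bar>u y\<bar> powr q"] by (simp add: algebra_simps)
      finally show "norm (u y * ?E y) \<le> norm (\<bar>u y\<bar> powr q + ?E y)"
        by (simp add: abs_mult)
    qed
  qed
qed

lemma gauss_tempered_add:
  assumes "gauss_tempered u" "gauss_tempered v"
  shows "gauss_tempered (\<lambda>y. u y + v y)"
  using assms by (auto simp: gauss_tempered_def distrib_right)

lemma gauss_tempered_cmult:
  assumes "gauss_tempered u"
  shows "gauss_tempered (\<lambda>y. c * u y)"
  using assms by (auto simp: gauss_tempered_def mult.assoc)

lemma gauss_tempered_integrable:
  fixes u k :: "'a::euclidean_space \<Rightarrow> real"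
  assumes u: "gauss_tempered u" and k: "k \<in> borel_measurable borel"
    and "c > 0" and bd: "\<And>x. \<bar>k x\<bar> \<le> M * exp (- c * (norm x)\<^sup>2)"
  shows "integrable lebesgue (\<lambda>y. u y * k (z - y))"
proof (rule Bochner_Integration.integrable_bound)
  show "integrable lebesgue (\<lambda>y. M * (u y * exp (- c * (norm (z - y))\<^sup>2)))"
    using u \<open>c > 0\<close> by (auto simp: gauss_tempered_def)
  have "(\<lambda>y. k (z - y)) \<in> borel_measurable lebesgue"
    using k by (intro borel_imp_lebesgue_measurable) simp
  then show "(\<lambda>y. u y * k (z - y)) \<in> borel_measurable lebesgue"
    using u by (auto simp: gauss_tempered_def)
  \<comment> \<open>The sign of \<open>M\<close> is not prescribed, hence
    \<open>\<bar>M\<bar>\<close>.\<close>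
  have "\<bar>u y\<bar> * \<bar>k (z - y)\<bar> \<le> \<bar>u y\<bar> * (\<bar>M\<bar> * exp (- c * (norm (z - y))\<^sup>2))" for y
    by (intro mult_left_mono order_trans[OF bd] mult_right_mono) auto
  then show "AE y in lebesgue. norm (u y * k (z - y)) \<le> norm (M * (u y * exp (- c * (norm (z - y))\<^sup>2)))"
    by (simp add: abs_mult mult_ac)
qed

section \<open>The derivative of the Gaussian kernel in the scale\<close>

text \<open>This is the texture kernel, \<open>s\<close> times the Laplacian of
  \<open>gauss_kernel s\<close>, in closed form.\<close>

definition gauss_kernel_deriv :: "real \<Rightarrow> real ^ 'n::finite \<Rightarrow> real" where
  "gauss_kernel_deriv s x = gauss_kernel s x * ((norm x)\<^sup>2 / s ^ 3 - real CARD('n) / s)"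

lemma borel_measurable_gauss_kernel [measurable]: "gauss_kernel s \<in> borel_measurable borel"
  unfolding gauss_kernel_def by measurable

lemma borel_measurable_gauss_kernel_deriv [measurable]: "gauss_kernel_deriv s \<in> borel_measurable borel"
  unfolding gauss_kernel_deriv_def by measurable

lemma gauss_kernel_nonneg: "gauss_kernel s x \<ge> 0"
  by (simp add: gauss_kernel_def)

lemma has_field_derivative_gauss_kernel:
  fixes x :: "real ^ 'n::finite"
  assumes "s > 0"
  shows "((\<lambda>s. gauss_kernel s x) has_field_derivative gauss_kernel_deriv s x) (at s)"
proof -
  let ?n = "real CARD('n)"
  \<comment> \<open>The logarithmic derivative of this factor is \<open>2 * a / s\<close>; the
    exponent of the kernel turns it into \<open>- ?n / s\<close>.\<close>
  have "((\<lambda>s. (2 * pi * s\<^sup>2) powr a) has_field_derivative 2 * a / s * (2 * pi * s\<^sup>2) powr a) (at s)" for a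
    using assms by (auto intro!: derivative_eq_intros simp: powr_diff field_simps power2_eq_square)
  from this[of "- ?n / 2"] have "((\<lambda>s. (2 * pi * s\<^sup>2) powr (- ?n / 2)) has_field_derivative
          - ?n / s * (2 * pi * s\<^sup>2) powr (- ?n / 2)) (at s)"
    by simp
  moreover have "((\<lambda>s. exp (- (norm x)\<^sup>2 / (2 * s\<^sup>2))) has_field_derivative
          (norm x)\<^sup>2 / s ^ 3 * exp (- (norm x)\<^sup>2 / (2 * s\<^sup>2))) (at s)"
    using assms
    by (auto intro!: derivative_eq_intros simp: field_simps power2_eq_square power3_eq_cube)
  ultimately have "((\<lambda>s. (2 * pi * s\<^sup>2) powr (- ?n / 2) * exp (- (norm x)\<^sup>2 / (2 * s\<^sup>2)))
     has_field_derivative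
       - ?n / s * (2 * pi * s\<^sup>2) powr (- ?n / 2) * exp (- (norm x)\<^sup>2 / (2 * s\<^sup>2))
       + (norm x)\<^sup>2 / s ^ 3 * exp (- (norm x)\<^sup>2 / (2 * s\<^sup>2)) * (2 * pi * s\<^sup>2) powr (- ?n / 2)) (at s)"
    by (rule DERIV_mult)
  then show ?thesis
    by (simp add: gauss_kernel_def gauss_kernel_deriv_def algebra_simps)
qed

text \<open>The normalising factor decreases in the scale and the exponential increases, so each is
  estimated at the opposite end of the range.\<close>

lemma gauss_kernel_le:
  fixes x :: "real ^ 'n::finite"
  assumes "0 < a" "a \<le> s" "s \<le> b"
  shows "gauss_kernel s x \<le> (2 * pi * a\<^sup>2) powr (- real CARD('n) / 2) * exp (- (norm x)\<^sup>2 / (2 * b\<^sup>2))"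
  unfolding gauss_kernel_def
proof (intro mult_mono)
  show "(2 * pi * s\<^sup>2) powr (- real CARD('n) / 2) \<le> (2 * pi * a\<^sup>2) powr (- real CARD('n) / 2)"
    using assms by (intro powr_mono2') auto
  show "exp (- (norm x)\<^sup>2 / (2 * s\<^sup>2)) \<le> exp (- (norm x)\<^sup>2 / (2 * b\<^sup>2))"
    using assms by (auto intro!: divide_left_mono mult_pos_pos)
qed auto

text \<open>Half of the Gaussian decay is spent on absorbing the quadratic factor; the other half
  remains as the bound, uniformly over the range of scales.\<close>

lemma gauss_kernel_deriv_bound:
  fixes a b :: real
  assumes "0 < a"
  obtains M c where "M > 0" "c > 0"
    "\<And>s x. a \<le> s \<Longrightarrow> s \<le> b \<Longrightarrow> \<bar>gauss_kernel_deriv s (x :: real ^ 'n::finite)\<bar> \<le> M * exp (- c * (norm x)\<^sup>2)"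
proof (cases "a \<le> b")
  \<comment> \<open>The range of scales is empty, so any positive constants serve.\<close>
  case False
  then show ?thesis using that[of 1 1] by force
next
  case True
  let ?n = "real CARD('n)"
  define A where "A = (2 * pi * a\<^sup>2) powr (- ?n / 2)"
  \<comment> \<open>Half of the rate \<open>1 / (2 * b\<^sup>2)\<close>, so that the Gaussian at
    scale \<open>b\<close> splits as \<open>?e * ?e\<close>.\<close>
  define c where "c = 1 / (4 * b\<^sup>2)"
  have b: "b > 0" using assms True by simp
  have A: "A > 0" using assms by (simp add: A_def)
  have c: "c > 0" using b by (simp add: c_def)
  show ?thesis
  proof (rule that)
    show "A * (1 / (c * a ^ 3) + ?n / a) > 0"
      using A c assms by (intro mult_pos_pos add_pos_pos) auto
    show "c > 0" by (fact c)
    fix s and x :: "real ^ 'n"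
    assume s: "a \<le> s" "s \<le> b"
    let ?e = "exp (- c * (norm x)\<^sup>2)"
    have e: "- (norm x)\<^sup>2 / (2 * b\<^sup>2) = - c * (norm x)\<^sup>2 + - c * (norm x)\<^sup>2"
      using b by (simp add: c_def field_simps)
    have g: "gauss_kernel s x \<le> A * (?e * ?e)"
      using gauss_kernel_le[OF assms s, of x] unfolding A_def[symmetric] e exp_add .
    \<comment> \<open>The inequality \<open>t \<le> exp t\<close> makes
      \<open>(norm x)\<^sup>2 * ?e\<close> bounded.\<close>
    have "c * (norm x)\<^sup>2 \<le> exp (c * (norm x)\<^sup>2)"
      using exp_ge_add_one_self[of "c * (norm x)\<^sup>2"] by linarith
    then have x: "(norm x)\<^sup>2 * ?e \<le> 1 / c"
      using c by (simp add: exp_minus field_simps)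
    have "\<bar>(norm x)\<^sup>2 / s ^ 3 - ?n / s\<bar> \<le> (norm x)\<^sup>2 / s ^ 3 + ?n / s"
      using s assms by (intro abs_leI) (auto simp: field_simps)
    also have "\<dots> \<le> (norm x)\<^sup>2 / a ^ 3 + ?n / a"
      using s assms by (intro add_mono divide_left_mono power_mono mult_pos_pos zero_less_power) auto
    finally have "\<bar>gauss_kernel_deriv s x\<bar> \<le> (A * (?e * ?e)) * ((norm x)\<^sup>2 / a ^ 3 + ?n / a)"
      unfolding gauss_kernel_deriv_def abs_mult using g gauss_kernel_nonneg[of s x] A assms
      by (intro mult_mono) auto
    also have "\<dots> = A * ((norm x)\<^sup>2 * ?e / a ^ 3 + ?n / a * ?e) * ?e"
      by (simp add: field_simps)
    \<comment> \<open>One factor \<open>?e\<close> is used up: against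
      \<open>(norm x)\<^sup>2\<close> in the first term, and by \<open>?e \<le> 1\<close> in the
      second.\<close>
    also have "\<dots> \<le> A * (1 / c / a ^ 3 + ?n / a * 1) * ?e"
      using A x c assms by (intro mult_right_mono mult_left_mono add_mono divide_right_mono) auto
    finally show "\<bar>gauss_kernel_deriv s x\<bar> \<le> A * (1 / (c * a ^ 3) + ?n / a) * ?e"
      by simp
  qed
qed

section \<open>Differentiation under the integral\<close>

lemma integrable_gauss_kernel:
  assumes "gauss_tempered u" "s > 0"
  shows "integrable lebesgue (\<lambda>y. u y * gauss_kernel s (z - y))"
proof (rule gauss_tempered_integrable[OF assms(1) borel_measurable_gauss_kernel])
  show "1 / (2 * s\<^sup>2) > 0" using assms by simp
  show "\<bar>gauss_kernel s x\<bar> \<le> (2 * pi * s\<^sup>2) powr (- real CARD('a) / 2) * exp (- (1 / (2 * s\<^sup>2)) * (norm x)\<^sup>2)"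
    for x :: "real ^ 'a"
    by (simp add: gauss_kernel_def abs_mult)
qed

text \<open>The uniform kernel bound is applied to the one-point range of scales from
  \<open>s\<close> to \<open>s\<close>.\<close>

lemma integrable_gauss_kernel_deriv:
  fixes z :: "real ^ 'a::finite"
  assumes "gauss_tempered u" "s > 0"
  shows "integrable lebesgue (\<lambda>y. u y * gauss_kernel_deriv s (z - y))"
proof -
  obtain M c where "c > 0" "\<And>x. \<bar>gauss_kernel_deriv s (x :: real ^ 'a)\<bar> \<le> M * exp (- c * (norm x)\<^sup>2)"
    using gauss_kernel_deriv_bound[OF assms(2), of s] by (metis order_refl)
  then show ?thesis
    by (rule gauss_tempered_integrable[OF assms(1) borel_measurable_gauss_kernel_deriv])
qed

text \<open>Differentiation under the integral: by the mean value theorem the difference quotients of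
  the kernel are dominated by a single Gaussian.\<close>
lemma has_field_derivative_conv_gauss_kernel:
  fixes u :: "real ^ 'n::finite \<Rightarrow> real"
  assumes u: "gauss_tempered u" and \<sigma>: "\<sigma> > 0"
  shows "((\<lambda>s. conv u (gauss_kernel s) z) has_field_derivative conv u (gauss_kernel_deriv \<sigma>) z) (at \<sigma>)"
proof -
  \<comment> \<open>A neighbourhood of \<open>\<sigma>\<close> that stays away from 0, so one
    Gaussian dominates the scale derivative on all of it.\<close>
  let ?S = "{\<sigma> / 2 <..< 2 * \<sigma>}"
  have "\<sigma> / 2 > 0" using \<sigma> by simp
  then obtain M c where M: "M > 0" and c: "c > 0" and bd:
    "\<And>s x. \<sigma> / 2 \<le> s \<Longrightarrow> s \<le> 2 * \<sigma> \<Longrightarrow> \<bar>gauss_kernel_deriv s (x :: real ^ 'n)\<bar> \<le> M * exp (- c * (norm x)\<^sup>2)"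
    using gauss_kernel_deriv_bound[where b = "2 * \<sigma>" and 'n = 'n] by blast
  have um: "u \<in> borel_measurable lebesgue" using u by (simp add: gauss_tempered_def)
  have km: "(\<lambda>y. gauss_kernel s (z - y)) \<in> borel_measurable lebesgue"
    "(\<lambda>y. gauss_kernel_deriv s (z - y)) \<in> borel_measurable lebesgue" for s
    by (auto intro!: borel_imp_lebesgue_measurable)
  have "((\<lambda>s. (conv u (gauss_kernel s) z - conv u (gauss_kernel \<sigma>) z) / (s - \<sigma>))
      \<longlongrightarrow> conv u (gauss_kernel_deriv \<sigma>) z) (at \<sigma> within ?S)"
    \<comment> \<open>Dominated convergence is a statement about sequences, so the limit is tested
      along each sequence \<open>X\<close> tending to \<open>\<sigma>\<close>.\<close>
    unfolding tendsto_at_iff_sequentially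
  proof (intro allI impI)
    fix X assume XS: "\<forall>i. X i \<in> ?S - {\<sigma>}" and X: "X \<longlonglongrightarrow> \<sigma>"
    define D where "D i x = (gauss_kernel (X i) x - gauss_kernel \<sigma> x) / (X i - \<sigma>)"
      for i and x :: "real ^ 'n"
    have X0: "X i > 0" for i using XS \<sigma> by (meson DiffD1 greaterThanLessThan_iff half_gt_zero less_trans)
    have lim: "(\<lambda>i. D i x) \<longlonglongrightarrow> gauss_kernel_deriv \<sigma> x" for x
      using has_field_derivative_gauss_kernel[OF \<sigma>, of x] X XS
      unfolding has_field_derivative_iff tendsto_at_iff_sequentially D_def by (auto simp: o_def)
    have D: "\<bar>D i x\<bar> \<le> M * exp (- c * (norm x)\<^sup>2)" for i x
    proof -
      \<comment> \<open>Mean value inequality on the convex set \<open>?S\<close>, for each fixed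
        \<open>x\<close>.\<close>
      have "norm (gauss_kernel (X i) x - gauss_kernel \<sigma> x) \<le> M * exp (- c * (norm x)\<^sup>2) * norm (X i - \<sigma>)"
        using XS \<sigma> bd
        by (intro field_differentiable_bound[of ?S _ "\<lambda>s. gauss_kernel_deriv s x"])
          (auto intro!: DERIV_subset[OF has_field_derivative_gauss_kernel])
      moreover have "X i \<noteq> \<sigma>" using XS by auto
      ultimately show ?thesis by (simp add: D_def field_simps)
    qed
    have "(\<lambda>i. LINT y|lebesgue. u y * D i (z - y)) \<longlonglongrightarrow> (LINT y|lebesgue. u y * gauss_kernel_deriv \<sigma> (z - y))"
    proof (rule integral_dominated_convergence)
      show "integrable lebesgue (\<lambda>y. M * \<bar>u y * exp (- c * (norm (z - y))\<^sup>2)\<bar>)"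
        using u c by (auto simp: gauss_tempered_def)
      show "AE y in lebesgue. (\<lambda>i. u y * D i (z - y)) \<longlonglongrightarrow> u y * gauss_kernel_deriv \<sigma> (z - y)"
        by (intro AE_I2 tendsto_mult tendsto_const lim)
      show "AE y in lebesgue. norm (u y * D i (z - y)) \<le> M * \<bar>u y * exp (- c * (norm (z - y))\<^sup>2)\<bar>" for i
        using mult_left_mono[OF D[of i], of "\<bar>u _\<bar>"] by (auto simp: abs_mult mult_ac)
    qed (use um km in \<open>auto simp: D_def\<close>)
    moreover have "(LINT y|lebesgue. u y * D i (z - y))
        = (conv u (gauss_kernel (X i)) z - conv u (gauss_kernel \<sigma>) z) / (X i - \<sigma>)" for i
      unfolding conv_def D_def
      using integrable_gauss_kernel[OF u X0[of i], of z] integrable_gauss_kernel[OF u \<sigma>, of z]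
      by (simp add: right_diff_distrib flip: Bochner_Integration.integral_diff)
    ultimately show "((\<lambda>s. (conv u (gauss_kernel s) z - conv u (gauss_kernel \<sigma>) z) / (s - \<sigma>)) \<circ> X)
        \<longlonglongrightarrow> conv u (gauss_kernel_deriv \<sigma>) z"
      by (simp add: o_def conv_def)
  qed
  then show ?thesis
    using \<sigma> at_within_open[of \<sigma> ?S] by (simp add: has_field_derivative_iff)
qed

lemma texture_eq_conv:
  assumes "gauss_tempered u" "\<sigma> > 0"
  shows "texture z u \<sigma> = conv u (gauss_kernel_deriv \<sigma>) z"
  unfolding texture_def by (rule DERIV_imp_deriv[OF has_field_derivative_conv_gauss_kernel[OF assms]])

lemma texture_well_defined_tempered:
  assumes "gauss_tempered u" "\<sigma> > 0"
  shows "texture_well_defined z u \<sigma>"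
  unfolding texture_well_defined_def
  using integrable_gauss_kernel[OF assms(1)] has_field_derivative_conv_gauss_kernel[OF assms]
  unfolding real_differentiable_def by blast

section \<open>Convolution on L^p and Young's inequality\<close>

text \<open>For each \<open>z\<close> the integrand changes only on a null set, so the values agree
  at every \<open>z\<close>. This serves both the passage to Borel representatives and the
  compatibility of the operator with almost everywhere equality.\<close>

lemma conv_cong_AE:
  assumes "u \<in> borel_measurable lebesgue" "v \<in> borel_measurable lebesgue" "k \<in> borel_measurable borel"
    and "AE x in lebesgue. u x = v x"
  shows "conv u k z = conv v k z"
proof -
  have "(\<lambda>y. k (z - y)) \<in> borel_measurable lebesgue"
    using assms(3) by (intro borel_imp_lebesgue_measurable) simp
  then show ?thesis
    unfolding conv_def using assms by (intro integral_cong_AE) auto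
qed

lemma borel_measurable_conv:
  assumes u: "u \<in> borel_measurable lebesgue" and k[measurable]: "k \<in> borel_measurable borel"
  shows "conv u k \<in> borel_measurable borel"
proof -
  obtain u' where [measurable]: "u' \<in> borel_measurable borel" and eq: "AE x in lebesgue. u x = u' x"
    using lebesgue_borel_representative[OF u] by blast
  have "conv u k = conv u' k"
    by (rule ext, rule conv_cong_AE[OF u borel_imp_lebesgue_measurable k eq]) simp
  also have "\<dots> = (\<lambda>z. \<integral>y. u' y * k (z - y) \<partial>lborel)"
    unfolding conv_def by (rule ext, rule integral_completion) simp
  also have "\<dots> \<in> borel_measurable borel"
    by measurable
  finally show ?thesis .
qed

text \<open>Tonelli and translation invariance; this is the case of exponent 1 of Young's
  inequality, with equality for nonnegative functions.\<close>

lemma nn_integral_conv: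
  fixes f k :: "'a::euclidean_space \<Rightarrow> ennreal"
  assumes f: "f \<in> borel_measurable borel" and [measurable]: "k \<in> borel_measurable borel"
  shows "(\<integral>\<^sup>+z. \<integral>\<^sup>+y. f y * k (z - y) \<partial>lborel \<partial>lborel) = (\<integral>\<^sup>+y. f y \<partial>lborel) * (\<integral>\<^sup>+x. k x \<partial>lborel)"
proof -
  note f[measurable]
  have "(\<integral>\<^sup>+z. \<integral>\<^sup>+y. f y * k (z - y) \<partial>lborel \<partial>lborel) = (\<integral>\<^sup>+y. \<integral>\<^sup>+z. f y * k (z - y) \<partial>lborel \<partial>lborel)"
    by (intro lborel_pair.Fubini') simp
  also have "\<dots> = (\<integral>\<^sup>+y. f y * (\<integral>\<^sup>+x. k x \<partial>lborel) \<partial>lborel)"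
    by (simp add: nn_integral_cmult nn_integral_shift)
  also have "\<dots> = (\<integral>\<^sup>+y. f y \<partial>lborel) * (\<integral>\<^sup>+x. k x \<partial>lborel)"
    by (simp add: nn_integral_multc)
  finally show ?thesis .
qed

text \<open>Young's inequality with the dominating Gaussian \<open>G\<close> in place of
  \<open>\<bar>k\<bar>\<close>. Its integral is positive whatever \<open>k\<close> is, as Jensen's
  inequality requires of the weight.\<close>

lemma Lp_conv_bound:
  fixes u k :: "real ^ 'n::finite \<Rightarrow> real" and c M :: real
  defines "G \<equiv> \<lambda>x :: real ^ 'n. M * exp (- c * (norm x)\<^sup>2)"
  assumes u: "u \<in> Lp_space p" and p: "p \<ge> 1"
    and k: "k \<in> borel_measurable borel" and M: "M > 0" and c: "c > 0"
    and bd: "\<And>x. \<bar>k x\<bar> \<le> G x"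
  shows "conv u k \<in> Lp_space p \<and> Lp_norm p (conv u k) \<le> (\<integral>x. G x \<partial>lborel) * Lp_norm p u"
proof -
  define C where "C = (\<integral>x. G x \<partial>lborel)"
  have um: "u \<in> borel_measurable lebesgue"
    using u by (auto simp: Lp_space_def split: if_splits)
  have Gm[measurable]: "G \<in> borel_measurable borel" unfolding G_def by measurable
  have Gi: "integrable lborel G"
    unfolding G_def using integrable_gaussian[OF c] by (intro integrable_mult_right)
  have Gpos: "G x > 0" for x using M by (simp add: G_def)
  have GM: "G x \<le> M" for x using M c by (simp add: G_def)
  have Gzm: "(\<lambda>y. G (z - y)) \<in> borel_measurable lebesgue" for z
    by (intro borel_imp_lebesgue_measurable) simp
  have Gzi: "integrable lebesgue (\<lambda>y. G (z - y))" for z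
    using integrable_reflect[OF Gm Gi, of z] by (subst integrable_completion) auto
  have Gz: "(LINT y|lebesgue. G (z - y)) = C" for z
    unfolding C_def using integral_reflect[OF Gm, of z] by (subst integral_completion) auto
  have C: "C > 0"
  proof -
    \<comment> \<open>A zero integral would make the strictly positive \<open>G\<close> vanish
      almost everywhere.\<close>
    have "C \<noteq> 0"
    proof
      assume "C = 0"
      then have "AE x in (lborel :: (real ^ 'n) measure). G x = 0"
        using integral_nonneg_eq_0_iff_AE[OF Gi] Gpos by (auto simp: C_def less_imp_le)
      then have "AE x in (lborel :: (real ^ 'n) measure). False"
        by eventually_elim (use Gpos less_irrefl in metis)
      then show False by (simp add: AE_iff_null null_sets_def)
    qed
    moreover have "C \<ge> 0"
      unfolding C_def using Gpos by (intro integral_nonneg_AE) (auto simp: less_imp_le)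
    ultimately show ?thesis by simp
  qed
  have ut: "gauss_tempered u" by (rule gauss_tempered_Lp[OF u p])
  have uG: "integrable lebesgue (\<lambda>y. \<bar>u y\<bar> * G (z - y))" for z
    using integrable_abs[OF gauss_tempered_integrable[OF ut Gm c, of M z]] Gpos
    by (simp add: abs_mult G_def M less_imp_le)
  have Tm: "conv u k \<in> borel_measurable borel" by (rule borel_measurable_conv[OF um k])
  then have Tl: "conv u k \<in> borel_measurable lebesgue" by (rule borel_imp_lebesgue_measurable)
  have T: "\<bar>conv u k z\<bar> \<le> (LINT y|lebesgue. \<bar>u y\<bar> * G (z - y))" for z
    unfolding conv_def
  proof (rule order_trans[OF integral_abs_bound integral_mono])
    show "integrable lebesgue (\<lambda>y. \<bar>u y * k (z - y)\<bar>)"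
      using gauss_tempered_integrable[OF ut k c, of M z] bd by (simp add: G_def)
    show "\<bar>u y * k (z - y)\<bar> \<le> \<bar>u y\<bar> * G (z - y)" for y
      using bd by (simp add: abs_mult mult_left_mono)
  qed (rule uG)
  have "conv u k \<in> Lp_space p \<and> Lp_norm p (conv u k) \<le> C * Lp_norm p u"
  proof (cases "p = \<infinity>")
    case True
    define L where "L = esssup lebesgue (\<lambda>x. ereal \<bar>u x\<bar>)"
    have "L < \<infinity>" using True u by (simp add: L_def Lp_space_def)
    \<comment> \<open>A negative essential supremum would force the whole space to be null. This
      also excludes \<open>-\<infinity>\<close>, which \<open>real_of_ereal\<close> would send to
      0.\<close>
    have nonneg: "esssup lebesgue (\<lambda>x. ereal \<bar>f x\<bar>) \<ge> 0" for f :: "real ^ 'n \<Rightarrow> real"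
    proof (rule ccontr)
      assume "\<not> ?thesis"
      then have "AE x in (lebesgue :: (real ^ 'n) measure). False"
        using esssup_AE[of "\<lambda>x. ereal \<bar>f x\<bar>" lebesgue]
        by (auto elim!: eventually_mono) (meson abs_ge_zero ereal_less_eq(5) order_trans)
      then have "AE x in (lborel :: (real ^ 'n) measure). False"
        by (simp only: AE_completion_iff)
      then show False by (simp add: AE_iff_null null_sets_def)
    qed
    obtain l where l: "L = ereal l" "l \<ge> 0"
      using \<open>L < \<infinity>\<close> nonneg[of u] by (cases L) (auto simp: L_def[symmetric])
    have ul: "AE x in lebesgue. \<bar>u x\<bar> \<le> l"
      using esssup_AE[of "\<lambda>x. ereal \<bar>u x\<bar>" lebesgue] by (simp flip: L_def add: l)
    have "\<bar>conv u k z\<bar> \<le> C * l" for z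
    proof -
      have "(LINT y|lebesgue. \<bar>u y\<bar> * G (z - y)) \<le> (LINT y|lebesgue. l * G (z - y))"
        using ul by (intro integral_mono_AE uG integrable_mult_right Gzi)
          (auto elim!: eventually_mono intro!: mult_right_mono simp: Gpos less_imp_le)
      then show ?thesis using T[of z] by (simp add: Gz mult.commute)
    qed
    then have *: "esssup lebesgue (\<lambda>x. ereal \<bar>conv u k x\<bar>) \<le> ereal (C * l)"
      using Tl by (intro esssup_I) auto
    have "real_of_ereal (esssup lebesgue (\<lambda>x. ereal \<bar>conv u k x\<bar>)) \<le> C * l"
      using real_of_ereal_positive_mono[OF nonneg *] by simp
    moreover have "Lp_norm p u = l" using True by (simp add: Lp_norm_def l flip: L_def)
    ultimately show ?thesis
      using True Tl * by (auto simp: Lp_space_def Lp_norm_def elim: order.strict_trans1)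
  next
    case False
    define q where "q = enn2real p"
    have q: "q \<ge> 1"
      using False p unfolding q_def
      by (metis enn2real_1 enn2real_mono infinity_ennreal_def less_top)
    have uq: "integrable lebesgue (\<lambda>y. \<bar>u y\<bar> powr q)"
      using False u by (simp add: Lp_space_def q_def)
    \<comment> \<open>Here boundedness of \<open>G\<close> is what counts:
      \<open>\<bar>u y\<bar> powr q\<close> is integrable and \<open>G \<le> M\<close>.\<close>
    have uqG: "integrable lebesgue (\<lambda>y. \<bar>u y\<bar> powr q * G (z - y))" for z
    proof (rule Bochner_Integration.integrable_bound)
      show "integrable lebesgue (\<lambda>y. \<bar>u y\<bar> powr q * M)" using uq by simp
      show "(\<lambda>y. \<bar>u y\<bar> powr q * G (z - y)) \<in> borel_measurable lebesgue"
        using uq Gzm by (intro borel_measurable_times) auto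
      show "AE y in lebesgue. norm (\<bar>u y\<bar> powr q * G (z - y)) \<le> norm (\<bar>u y\<bar> powr q * M)"
        using GM Gpos M by (auto simp: abs_mult less_imp_le intro!: mult_left_mono)
    qed
    obtain u' where u'[measurable]: "u' \<in> borel_measurable borel" and eq: "AE x in lebesgue. u x = u' x"
      using lebesgue_borel_representative[OF um] by blast
    define I where "I = (LINT y|lebesgue. \<bar>u y\<bar> powr q)"
    have I: "I \<ge> 0" by (simp add: I_def)
    have "(\<integral>\<^sup>+z. ennreal (\<bar>conv u k z\<bar> powr q) \<partial>lebesgue)
        \<le> (\<integral>\<^sup>+z. ennreal (C powr (q - 1)) * (\<integral>\<^sup>+y. ennreal (\<bar>u' y\<bar> powr q) * ennreal (G (z - y)) \<partial>lborel) \<partial>lebesgue)"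
    proof (rule nn_integral_mono)
      fix z
      have "\<bar>conv u k z\<bar> powr q \<le> (LINT y|lebesgue. \<bar>u y\<bar> * G (z - y)) powr q"
        using T q by (intro powr_mono2) auto
      \<comment> \<open>Jensen with weight \<open>G (z - y)\<close> in the variable
        \<open>y\<close>, whose total mass is \<open>C\<close> for every \<open>z\<close>.\<close>
      also have "\<dots> \<le> C powr (q - 1) * (LINT y|lebesgue. \<bar>u y\<bar> powr q * G (z - y))"
        using Gpos q Gzi uG uqG C Gz by (intro powr_integral_le) (auto simp: less_imp_le)
      finally have "ennreal (\<bar>conv u k z\<bar> powr q)
          \<le> ennreal (C powr (q - 1)) * ennreal (LINT y|lebesgue. \<bar>u y\<bar> powr q * G (z - y))"
        by (simp add: ennreal_leI flip: ennreal_mult')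
      also have "ennreal (LINT y|lebesgue. \<bar>u y\<bar> powr q * G (z - y))
          = (\<integral>\<^sup>+y. ennreal (\<bar>u y\<bar> powr q * G (z - y)) \<partial>lebesgue)"
        using uqG Gpos by (intro nn_integral_eq_integral[symmetric]) (auto simp: less_imp_le)
      also have "\<dots> = (\<integral>\<^sup>+y. ennreal (\<bar>u' y\<bar> powr q) * ennreal (G (z - y)) \<partial>lebesgue)"
        using eq by (intro nn_integral_cong_AE) (auto elim!: eventually_mono simp: ennreal_mult' )
      also have "\<dots> = (\<integral>\<^sup>+y. ennreal (\<bar>u' y\<bar> powr q) * ennreal (G (z - y)) \<partial>lborel)"
        by (rule nn_integral_completion)
      finally show "ennreal (\<bar>conv u k z\<bar> powr q)
          \<le> ennreal (C powr (q - 1)) * (\<integral>\<^sup>+y. ennreal (\<bar>u' y\<bar> powr q) * ennreal (G (z - y)) \<partial>lborel)" .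
    qed
    also have "\<dots> = ennreal (C powr (q - 1)) *
        (\<integral>\<^sup>+z. \<integral>\<^sup>+y. ennreal (\<bar>u' y\<bar> powr q) * ennreal (G (z - y)) \<partial>lborel \<partial>lborel)"
      unfolding nn_integral_completion by (intro nn_integral_cmult) measurable
    also have "\<dots> = ennreal (C powr (q - 1)) * ((\<integral>\<^sup>+y. ennreal (\<bar>u' y\<bar> powr q) \<partial>lborel) * (\<integral>\<^sup>+x. ennreal (G x) \<partial>lborel))"
      by (subst nn_integral_conv) auto
    also have "(\<integral>\<^sup>+y. ennreal (\<bar>u' y\<bar> powr q) \<partial>lborel) = (\<integral>\<^sup>+y. ennreal (\<bar>u' y\<bar> powr q) \<partial>lebesgue)"
      by (rule nn_integral_completion[symmetric])
    also have "\<dots> = (\<integral>\<^sup>+y. ennreal (\<bar>u y\<bar> powr q) \<partial>lebesgue)"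
      using eq by (intro nn_integral_cong_AE) (auto elim!: eventually_mono)
    also have "\<dots> = ennreal I"
      unfolding I_def using uq by (intro nn_integral_eq_integral) auto
    also have "(\<integral>\<^sup>+x. ennreal (G x) \<partial>lborel) = ennreal C"
      unfolding C_def using Gi Gpos by (intro nn_integral_eq_integral) (auto simp: less_imp_le)
    \<comment> \<open>Jensen contributes \<open>C powr (q - 1)\<close> and Tonelli one further
      \<open>C\<close>; the \<open>q\<close>-th root then leaves exactly \<open>C\<close>.\<close>
    also have "ennreal (C powr (q - 1)) * (ennreal I * ennreal C) = ennreal (C powr q * I)"
      using C I by (simp add: powr_diff flip: ennreal_mult)
    finally have nn: "(\<integral>\<^sup>+z. ennreal (\<bar>conv u k z\<bar> powr q) \<partial>lebesgue) \<le> ennreal (C powr q * I)" .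
    have mq: "(\<lambda>z. \<bar>conv u k z\<bar> powr q) \<in> borel_measurable lebesgue"
      using Tl by measurable
    \<comment> \<open>Integrability comes from the finite extended integral \<open>nn\<close>,
      before the real integrals are compared.\<close>
    have iT: "integrable lebesgue (\<lambda>z. \<bar>conv u k z\<bar> powr q)"
      using nn mq by (intro integrableI_bounded) (auto simp: le_less_trans)
    have "(LINT z|lebesgue. \<bar>conv u k z\<bar> powr q) \<le> C powr q * I"
      using nn I iT by (subst (asm) nn_integral_eq_integral) auto
    then have "(LINT z|lebesgue. \<bar>conv u k z\<bar> powr q) powr (1 / q) \<le> (C powr q * I) powr (1 / q)"
      using q by (intro powr_mono2) auto
    also have "\<dots> = C * I powr (1 / q)"
      using C I q by (simp add: powr_mult powr_powr)
    finally show ?thesis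
      using False Tl iT by (simp add: Lp_space_def Lp_norm_def I_def flip: q_def)
  qed
  then show ?thesis by (simp add: C_def)
qed

theorem proposition3p5:
  fixes \<sigma> :: real
  assumes "\<sigma> > 0"
  shows "(\<forall>p\<ge>1.
            (\<forall>u\<in>Lp_space p. \<forall>z :: real ^ 'n::finite. texture_well_defined z u \<sigma>) \<and>
            bounded_linear_Lp p (\<lambda>u (z :: real ^ 'n). texture z u \<sigma>)) \<and>
         (\<exists>C :: real. \<forall>p\<ge>1. \<forall>u\<in>Lp_space p.
            Lp_norm p (\<lambda>z :: real ^ 'n. texture z u \<sigma>) \<le> C * Lp_norm p u)"
proof -
  obtain M c where M: "M > 0" and c: "c > 0" and bd:
    "\<And>x. \<bar>gauss_kernel_deriv \<sigma> (x :: real ^ 'n)\<bar> \<le> M * exp (- c * (norm x)\<^sup>2)"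
    using gauss_kernel_deriv_bound[OF assms, of \<sigma>] by (metis order_refl)
  \<comment> \<open>Fixed before any exponent is chosen, since \<open>M\<close> and \<open>c\<close>
    depend on the kernel alone; it serves as the common constant and as the bound \<open>K\<close>
    for each \<open>p\<close>.\<close>
  define C where "C = (\<integral>x. M * exp (- c * (norm (x :: real ^ 'n))\<^sup>2) \<partial>lborel)"
  have T: "(\<lambda>z. texture z u \<sigma>) = conv u (gauss_kernel_deriv \<sigma>)"
    if "gauss_tempered u" for u :: "real ^ 'n \<Rightarrow> real"
    using texture_eq_conv[OF that assms] by auto
  have Young: "(\<lambda>z. texture z u \<sigma>) \<in> Lp_space p"
    "Lp_norm p (\<lambda>z. texture z u \<sigma>) \<le> C * Lp_norm p u"
    if "p \<ge> 1" "u \<in> Lp_space p" for p and u :: "real ^ 'n \<Rightarrow> real"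
    using Lp_conv_bound[OF that(2,1) borel_measurable_gauss_kernel_deriv M c bd] that
    unfolding T[OF gauss_tempered_Lp[OF that(2,1)]] C_def by auto
  have "bounded_linear_Lp p (\<lambda>u (z :: real ^ 'n). texture z u \<sigma>)" if p: "p \<ge> 1" for p
    unfolding bounded_linear_Lp_def
  proof (intro conjI ballI allI impI)
    fix u v :: "real ^ 'n \<Rightarrow> real" and a :: real
    assume "u \<in> Lp_space p"
    then have u: "gauss_tempered u" by (rule gauss_tempered_Lp[OF _ p])
    note iu = integrable_gauss_kernel_deriv[OF u assms]
    \<comment> \<open>The multiple, and below the sum, are handled as tempered functions, so their
      textures are convolutions too and linearity holds at every point.\<close>
    show "AE x in lebesgue. texture x (\<lambda>y. a * u y) \<sigma> = a * texture x u \<sigma>"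
      using u gauss_tempered_cmult[OF u, of a] assms
      by (simp add: texture_eq_conv conv_def mult.assoc)
    assume "v \<in> Lp_space p"
    then have v: "gauss_tempered v" by (rule gauss_tempered_Lp[OF _ p])
    note iv = integrable_gauss_kernel_deriv[OF v assms]
    show "AE x in lebesgue. texture x (\<lambda>y. u y + v y) \<sigma> = texture x u \<sigma> + texture x v \<sigma>"
      using u v gauss_tempered_add[OF u v] assms iu iv
      by (simp add: texture_eq_conv conv_def distrib_right)
    assume "AE x in lebesgue. u x = v x"
    then show "AE x in lebesgue. texture x u \<sigma> = texture x v \<sigma>"
      using u v assms by (auto simp: texture_eq_conv gauss_tempered_def intro!: AE_I2 conv_cong_AE)
  qed (use Young[OF p] in auto)
  then show ?thesis
    using texture_well_defined_tempered[OF gauss_tempered_Lp assms] Young(2) by blast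
qed

end
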